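(* Let $X$ be a Hausdorff space. (a) There is an embedding of $X$ into the ray space $\mathcal{R}(T)$ of a tree $T$ if and only if $X$ admits a nested clopen subbase that is noetherian. (b) There is an embedding of $X$ into the ray space $\mathcal{R}(T)$ of a special tree $T$ if and only if $X$ admits a nested clopen subbase that is noetherian and $\sigma$-disjoint. (c) There is a surjective embedding of $X$ into (i.e. $X$ is homeomorphic to) the ray space $\mathcal{R}(T)$ of a tree $T$ if and only if $X$ admits a hereditarily complete nested clopen subbase that is noetherian. (d) There is a surjective embedding of $X$ into (i.e. $X$ is homeomorphic to) the ray space $\mathcal{R}(T)$ of a special tree $T$ if and only if $X$ admits a hereditarily complete nested clopen subbase that is noetherian and $\sigma$-disjoint.
   Context: Trees: A tree is a partially ordered set $T$ with a unique minimal element such that the set of predecessors of any element is well-ordered (distinct limit nodes may have the same set of strict predecessors). It is special if it is a union of countably many antichains. A path in $T$ is a nonempty down-closed chain; a ray is a path without maximal element. The ray space $\mathcal{R}(T)$ is the set of all rays of $T$ with the subspace topology inherited from $2^T$ (product topology), rays being identified with their characteristic functions. Subbases: A collection $\mathcal{A}$ of subsets of a topological space $(X,\tau)$ is - a clopen subbase for $X$ if $\tau$ is the smallest topology on $X$ containing all elements of $\mathcal{A}$ as clopen subsets (equivalently, $\mathcal{A}\cup\{X\setminus A: A\in\mathcal{A}\}$ is an open subbase); - nested if for all $A,B\in\mathcal{A}$ with $A\cap B\neq\emptyset$ we have $A\subseteq B$ or $B\subseteq A$; - noetherian if every $\subseteq$-increasing sequence of elements of $\mathcal{A}$ is eventually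 constant; - centered if every nonempty finite subfamily of $\mathcal{A}$ has nonempty intersection; - complete if every nonempty centered subfamily of $\mathcal{A}$ has nonempty intersection; - hereditarily complete if for every closed subspace $Y\subseteq X$ the collection $\{A\cap Y: A\in\mathcal{A}\}$ is complete; - $\sigma$-disjoint if $\mathcal{A}$ is a countable union of subcollections each consisting of pairwise disjoint sets. *)

theory Defs
  imports "HOL-Analysis.Analysis"
begin

section \<open>Trees and their ray spaces\<close>

text \<open>A tree is given by its reflexive order relation \<open>r\<close>; its set of nodes is \<open>Field r\<close>.
  Trees need not be Hausdorff: distinct limit nodes may have the same strict predecessors.\<close>

definition is_tree :: "'t rel \<Rightarrow> bool" where
  "is_tree r \<longleftrightarrow>
     Partial_order r \<and>
     (\<exists>!m. m \<in> Field r \<and> (\<forall>s. (s, m) \<in> r \<longrightarrow> s = m)) \<and>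
     (\<forall>t\<in>Field r. well_order_on (underS r t) (Restr r (underS r t)))"

definition antichain_in :: "'t rel \<Rightarrow> 't set \<Rightarrow> bool" where
  "antichain_in r A \<longleftrightarrow> A \<subseteq> Field r \<and> (\<forall>s\<in>A. \<forall>t\<in>A. (s, t) \<in> r \<longrightarrow> s = t)"

definition special_tree :: "'t rel \<Rightarrow> bool" where
  "special_tree r \<longleftrightarrow>
     is_tree r \<and>
     (\<exists>\<C>. countable \<C> \<and> (\<forall>A\<in>\<C>. antichain_in r A) \<and> \<Union>\<C> = Field r)"

text \<open>Membership in \<^const>\<open>Chains\<close> forces \<open>P \<subseteq> Field r\<close>.\<close>

definition tree_path :: "'t rel \<Rightarrow> 't set \<Rightarrow> bool" where
  "tree_path r P \<longleftrightarrow> P \<noteq> {} \<and> P \<in> Chains r \<and> (\<forall>t\<in>P. under r t \<subseteq> P)"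

definition tree_ray :: "'t rel \<Rightarrow> 't set \<Rightarrow> bool" where
  "tree_ray r P \<longleftrightarrow> tree_path r P \<and> \<not> (\<exists>m\<in>P. \<forall>s\<in>P. (m, s) \<in> r \<longrightarrow> s = m)"

text \<open>The points of the power \<open>2\<^sup>T\<close> are functions restricted to \<open>T = Field r\<close>
  (unspecified outside \<open>T\<close>), so a ray is represented by its restricted characteristic
  function.\<close>

definition ray_space :: "'t rel \<Rightarrow> ('t \<Rightarrow> bool) topology" where
  "ray_space r =
     subtopology (product_topology (\<lambda>_. discrete_topology (UNIV :: bool set)) (Field r))
       ((\<lambda>P. restrict (\<lambda>t. t \<in> P) (Field r)) ` {P. tree_ray r P})"

section \<open>Subbases\<close>

definition clopen_subbase :: "'a topology \<Rightarrow> 'a set set \<Rightarrow> bool" where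
  "clopen_subbase X \<A> \<longleftrightarrow>
     (\<forall>A\<in>\<A>. openin X A \<and> closedin X A) \<and>
     (\<forall>Y. topspace Y = topspace X \<and> (\<forall>A\<in>\<A>. openin Y A \<and> closedin Y A)
        \<longrightarrow> (\<forall>U. openin X U \<longrightarrow> openin Y U))"

definition nested_family :: "'a set set \<Rightarrow> bool" where
  "nested_family \<A> \<longleftrightarrow> (\<forall>A\<in>\<A>. \<forall>B\<in>\<A>. A \<inter> B \<noteq> {} \<longrightarrow> A \<subseteq> B \<or> B \<subseteq> A)"

definition noetherian_family :: "'a set set \<Rightarrow> bool" where
  "noetherian_family \<A> \<longleftrightarrow>
     (\<forall>A :: nat \<Rightarrow> 'a set. (\<forall>n. A n \<in> \<A>) \<and> incseq A \<longrightarrow> (\<exists>N. \<forall>n\<ge>N. A n = A N))"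

definition centered_family :: "'a set set \<Rightarrow> bool" where
  "centered_family \<A> \<longleftrightarrow> (\<forall>\<F>. \<F> \<subseteq> \<A> \<and> finite \<F> \<and> \<F> \<noteq> {} \<longrightarrow> \<Inter>\<F> \<noteq> {})"

definition complete_family :: "'a set set \<Rightarrow> bool" where
  "complete_family \<A> \<longleftrightarrow> (\<forall>\<C>. \<C> \<subseteq> \<A> \<and> \<C> \<noteq> {} \<and> centered_family \<C> \<longrightarrow> \<Inter>\<C> \<noteq> {})"

definition hereditarily_complete :: "'a topology \<Rightarrow> 'a set set \<Rightarrow> bool" where
  "hereditarily_complete X \<A> \<longleftrightarrow>
     (\<forall>Y. closedin X Y \<longrightarrow> complete_family ((\<lambda>A. A \<inter> Y) ` \<A>))"

definition sigma_disjoint :: "'a set set \<Rightarrow> bool" where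
  "sigma_disjoint \<A> \<longleftrightarrow>
     (\<exists>\<DD>. countable \<DD> \<and> (\<forall>\<D>\<in>\<DD>. pairwise disjnt \<D>) \<and> \<Union>\<DD> = \<A>)"

section \<open>Embeddings into ray spaces\<close>

definition embeds_into :: "'a topology \<Rightarrow> 'b topology \<Rightarrow> bool" where
  "embeds_into X Y \<longleftrightarrow> (\<exists>f. embedding_map X Y f)"

definition embeds_onto :: "'a topology \<Rightarrow> 'b topology \<Rightarrow> bool" where
  "embeds_onto X Y \<longleftrightarrow> (\<exists>f. embedding_map X Y f \<and> f ` topspace X = topspace Y)"

text \<open>HOL cannot quantify existentially over types, so ``there is a tree'' is
  rendered as follows. A space with points in \<open>'a\<close> that has a suitable subbase is to be
  realised by a tree with nodes in \<open>'a set \<times> nat\<close>; this type is large enough because nodes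
  can be taken to be pairs \<open>(A, n)\<close> of a nonempty member \<open>A\<close> of the subbase (or the
  whole space) and a number \<open>n\<close>, where the \<open>(A, n)\<close> form a finite or infinite
  chain placed at \<open>A\<close>.
  In the converse direction the nodes of the tree range over an arbitrary type.\<close>

end

theory Submission
  imports Defs
begin

text \<open>If \<open>X\<close> is embedded in a ray space, the sets of points whose ray passes through a given node
  form the required subbase: comparable nodes give nested sets, incomparable ones disjoint sets,
  and noetherianness is the well-foundedness of the tree. A centered family traced on a closed set
  \<open>Y\<close> belongs to a chain of nodes; the ray below this chain lies in \<open>Y\<close>, or, by pigeonhole on
  a basic neighbourhood of it missing \<open>Y\<close>, some node on a ray of \<open>Y\<close> lies above the whole chain.

  Conversely, the nonempty members of a subbase and the whole space form a tree under reverse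
  inclusion, and a point \<open>x\<close> is sent to the path of the members containing it. A ray missed by this
  map is a chain of members without least element whose intersection \<open>Z\<close> is covered by the
  smaller members; then \<open>Z\<close> is open, and the chain is centered but has empty intersection on the
  closed set \<open>X - Z\<close>, contrary to hereditary completeness.\<close>

section \<open>Trees and ray spaces\<close>

text \<open>Only predecessor sets are well-ordered by definition, so a node \<open>t\<close> of
  \<open>Q\<close> is fixed and the least element of \<open>Q\<close> strictly below
  \<open>t\<close>, if any, is taken; transitivity makes it minimal in all of
  \<open>Q\<close>.\<close>

lemma is_tree_strict_wf:
  assumes "is_tree r"
  shows "wf (r - Id)"
  unfolding wf_eq_minimal
proof (intro allI impI)
  fix Q :: "'a set" and t
  assume t: "t \<in> Q"
  show "\<exists>z\<in>Q. \<forall>y. (y, z) \<in> r - Id \<longrightarrow> y \<notin> Q"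
  proof (cases "Q \<inter> underS r t = {}")
    case True
    then show ?thesis using t by (auto simp: underS_def)
  next
    case False
    then have "t \<in> Field r" by (auto simp: underS_def intro: FieldI2)
    then have "wf (Restr r (underS r t) - Id)"
      using assms by (auto simp: is_tree_def well_order_on_def)
    then obtain z where z: "z \<in> Q \<inter> underS r t"
      and min: "\<And>y. (y, z) \<in> Restr r (underS r t) - Id \<Longrightarrow> y \<notin> Q \<inter> underS r t"
      using False by (metis wfE_min')
    have "trans r" "antisym r"
      using assms by (auto simp: is_tree_def order_on_defs)
    have "y \<notin> Q" if "(y, z) \<in> r - Id" for y
    proof -
      have zt: "(z, t) \<in> r" "z \<noteq> t" and yz: "(y, z) \<in> r" "y \<noteq> z"
        using that z by (auto simp: underS_def)
      then have "(y, t) \<in> r" using \<open>trans r\<close> by (meson transD)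
      moreover have "y \<noteq> t" using zt yz \<open>antisym r\<close> by (metis antisymD)
      ultimately have "y \<in> underS r t" by (simp add: underS_def)
      moreover have "z \<in> underS r t" using z by blast
      ultimately show ?thesis using min[of y] that by simp
    qed
    then show ?thesis using z by blast
  qed
qed

section \<open>Rays as points of a product of two-point spaces\<close>

abbreviation ray_fun :: "'t rel \<Rightarrow> 't set \<Rightarrow> 't \<Rightarrow> bool" where
  "ray_fun r P \<equiv> restrict (\<lambda>t. t \<in> P) (Field r)"

lemma topspace_ray_space: "topspace (ray_space r) = ray_fun r ` {P. tree_ray r P}"
  by (auto simp: ray_space_def)


lemma continuous_map_discrete_bool:
  "continuous_map X (discrete_topology (UNIV :: bool set)) p \<longleftrightarrow>
     openin X {x \<in> topspace X. p x} \<and> closedin X {x \<in> topspace X. p x}"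
proof -
  have compl: "topspace X - {x \<in> topspace X. p x} = {x \<in> topspace X. \<not> p x}" by blast
  have cases: "{x \<in> topspace X. p x \<in> U} =
      (if True \<in> U then {x \<in> topspace X. p x} else {}) \<union>
      (if False \<in> U then {x \<in> topspace X. \<not> p x} else {})" for U
    by auto (metis (full_types))+
  show ?thesis
  proof
    assume p: "continuous_map X (discrete_topology (UNIV :: bool set)) p"
    have "openin X {x \<in> topspace X. p x \<in> U}" for U
      using p by (simp add: continuous_map_def)
    from this[of "{True}"] this[of "{False}"] show "openin X {x \<in> topspace X. p x} \<and> closedin X {x \<in> topspace X. p x}"
      by (simp add: closedin_def compl Collect_mono_iff)
  next
    assume "openin X {x \<in> topspace X. p x} \<and> closedin X {x \<in> topspace X. p x}"
    then have "openin X {x \<in> topspace X. p x}" "openin X {x \<in> topspace X. \<not> p x}"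
      by (simp_all add: closedin_def compl)
    then show "continuous_map X (discrete_topology (UNIV :: bool set)) p"
      using openin_Un by (auto simp: continuous_map_def cases)
  qed
qed

text \<open>Continuity into a subspace of a product is checked on coordinates; the coordinate at
  \<open>t\<close> has values in the discrete space \<open>bool\<close>, so it is continuous iff its
  truth set is clopen.\<close>

lemma continuous_map_ray_space:
  "continuous_map X (ray_space r) f \<longleftrightarrow>
     f \<in> topspace X \<rightarrow> topspace (ray_space r) \<and>
     (\<forall>t\<in>Field r. openin X {x \<in> topspace X. f x t} \<and> closedin X {x \<in> topspace X. f x t})"
proof -
  have "f ` topspace X \<subseteq> extensional (Field r)" if "f \<in> topspace X \<rightarrow> topspace (ray_space r)"
    using that by (auto simp: topspace_ray_space extensional_def Pi_iff image_iff)
  then show ?thesis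
    unfolding continuous_map_discrete_bool[symmetric]
    unfolding topspace_ray_space unfolding ray_space_def continuous_map_in_subtopology
      continuous_map_componentwise by blast
qed

lemma ray_funE:
  assumes "g \<in> topspace (ray_space r)"
  obtains P where "tree_ray r P" "P = {t. t \<in> Field r \<and> g t}" "g = ray_fun r P"
proof -
  obtain P where P: "tree_ray r P" "g = ray_fun r P"
    using assms by (auto simp: topspace_ray_space)
  have "P \<subseteq> Field r"
    using P(1) by (auto simp: tree_ray_def tree_path_def Chains_def intro: FieldI1)
  then have "P = {t. t \<in> Field r \<and> g t}" using P(2) by auto
  then show ?thesis using that P by blast
qed

lemma ray_comparable:
  assumes "g \<in> topspace (ray_space r)" "s \<in> Field r" "t \<in> Field r" "g s" "g t"
  shows "(s, t) \<in> r \<or> (t, s) \<in> r"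
proof -
  obtain P where "tree_ray r P" "g = ray_fun r P" using assms(1) by (rule ray_funE)
  then show ?thesis using assms unfolding tree_ray_def tree_path_def Chains_def by auto
qed

lemma ray_down:
  assumes "g \<in> topspace (ray_space r)" "(s, t) \<in> r" "g t"
  shows "g s"
proof -
  obtain P where P: "tree_ray r P" "P = {t. t \<in> Field r \<and> g t}" using assms(1) by (rule ray_funE)
  have "t \<in> P" using P(2) assms(2,3) by (auto intro: FieldI2)
  then have "s \<in> P" using P(1) assms(2) by (auto simp: tree_ray_def tree_path_def under_def)
  then show ?thesis using P(2) by simp
qed

section \<open>The subbase of an embedding into a ray space\<close>

locale ray_embedding =
  fixes X :: "'a topology" and r :: "'t rel" and f :: "'a \<Rightarrow> 't \<Rightarrow> bool"
  assumes tree: "is_tree r" and emb: "embedding_map X (ray_space r) f"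
begin

text \<open>The preimage under \<open>f\<close> of the subbasic clopen set of \<open>2^T\<close>
  that belongs to the coordinate \<open>t\<close>.\<close>

definition rays_through :: "'t \<Rightarrow> 'a set" where
  "rays_through t = {x \<in> topspace X. f x t}"

definition node_family :: "'a set set" where
  "node_family = rays_through ` Field r"

section \<open>The node sets as a nested noetherian clopen subbase\<close>

lemma hom: "homeomorphic_map X (subtopology (ray_space r) (f ` topspace X)) f"
  using emb by (simp add: embedding_map_def)

lemma cont: "continuous_map X (ray_space r) f"
  using homeomorphic_imp_continuous_map[OF hom] by (simp add: continuous_map_in_subtopology)

lemma f_in: "x \<in> topspace X \<Longrightarrow> f x \<in> topspace (ray_space r)"
  using cont by (auto simp: continuous_map_def)

lemma rays_through_mono: "(s, t) \<in> r \<Longrightarrow> rays_through t \<subseteq> rays_through s"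
  unfolding rays_through_def using ray_down[OF f_in] by blast

lemma rays_through_comparable:
  assumes "s \<in> Field r" "t \<in> Field r" "rays_through s \<inter> rays_through t \<noteq> {}"
  shows "(s, t) \<in> r \<or> (t, s) \<in> r"
  using assms ray_comparable[OF f_in] unfolding rays_through_def by blast

text \<open>If the node sets are clopen in \<open>Y\<close>, then \<open>f\<close> is continuous on
  \<open>Y\<close> too; every open set of \<open>X\<close> is the preimage under \<open>f\<close> of
  an open set of rays, hence open in \<open>Y\<close>.\<close>

lemma clopen_subbase_node_family: "clopen_subbase X node_family"
  unfolding clopen_subbase_def
proof (intro conjI allI impI)
  show "\<forall>A\<in>node_family. openin X A \<and> closedin X A"
    using cont by (auto simp: continuous_map_ray_space node_family_def rays_through_def)
  fix Y U
  assume Y: "topspace Y = topspace X \<and> (\<forall>A\<in>node_family. openin Y A \<and> closedin Y A)"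
    and U: "openin X U"
  have contY: "continuous_map Y (ray_space r) f"
    using Y f_in by (auto simp: continuous_map_ray_space node_family_def rays_through_def)
  have "openin (subtopology (ray_space r) (f ` topspace X)) (f ` U)"
    using homeomorphic_map_openness[OF hom openin_subset[OF U]] U by simp
  then obtain V where V: "openin (ray_space r) V" "f ` U = V \<inter> f ` topspace X"
    by (auto simp: openin_subtopology)
  have inj: "inj_on f (topspace X)" using hom by (rule homeomorphic_imp_injective_map)
  have "U = {x \<in> topspace Y. f x \<in> V}"
  proof
    show "U \<subseteq> {x \<in> topspace Y. f x \<in> V}" using V(2) Y openin_subset[OF U] by auto
    show "{x \<in> topspace Y. f x \<in> V} \<subseteq> U"
    proof
      fix x assume "x \<in> {x \<in> topspace Y. f x \<in> V}"
      then have x: "x \<in> topspace X" "f x \<in> f ` U" using V(2) Y by auto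
      then show "x \<in> U" using inj openin_subset[OF U] by (auto simp: inj_on_def subset_iff)
    qed
  qed
  then show "openin Y U" using openin_continuous_map_preimage[OF contY V(1)] by simp
qed

lemma nested_node_family: "nested_family node_family"
  unfolding nested_family_def
proof (intro ballI impI)
  fix A B
  assume "A \<in> node_family" "B \<in> node_family" and meet: "A \<inter> B \<noteq> {}"
  then obtain s t where st: "s \<in> Field r" "t \<in> Field r" "A = rays_through s" "B = rays_through t"
    by (auto simp: node_family_def)
  then have "(s, t) \<in> r \<or> (t, s) \<in> r" using rays_through_comparable[of s t] meet by simp
  then show "A \<subseteq> B \<or> B \<subseteq> A" using rays_through_mono st by metis
qed

text \<open>Among the nodes whose sets occur in the sequence a minimal one \<open>t\<close> is
  chosen. A later, larger set belongs to a node comparable with \<open>t\<close> and, by minimality,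
  not strictly below it, so the set has not grown.\<close>

lemma noetherian_node_family: "noetherian_family node_family"
  unfolding noetherian_family_def
proof (intro allI impI)
  fix A :: "nat \<Rightarrow> 'a set"
  assume A: "(\<forall>n. A n \<in> node_family) \<and> incseq A"
  \<comment> \<open>Nodes with empty set are left out, since comparability of nodes is known only
    when their sets meet.\<close>
  define Q where "Q = {t \<in> Field r. rays_through t \<noteq> {} \<and> rays_through t \<in> range A}"
  show "\<exists>N. \<forall>n\<ge>N. A n = A N"
  proof (cases "Q = {}")
    case True
    have "A n = {}" for n
    proof (rule ccontr)
      assume n: "A n \<noteq> {}"
      obtain t where "t \<in> Field r" "A n = rays_through t" using A by (auto simp: node_family_def)
      then show False using True n unfolding Q_def by blast
    qed
    then show ?thesis by simp
  next
    case False
    then obtain t where t: "t \<in> Q" and min: "\<And>s. (s, t) \<in> r - Id \<Longrightarrow> s \<notin> Q"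
      using is_tree_strict_wf[OF tree] by (metis wfE_min')
    obtain N where N: "A N = rays_through t" using t by (auto simp: Q_def)
    have "A n = A N" if "n \<ge> N" for n
    proof -
      obtain s where s: "s \<in> Field r" "A n = rays_through s"
        using A by (auto simp: node_family_def)
      have sub: "A N \<subseteq> A n" using A that by (auto simp: incseq_def)
      then have "s \<in> Q" using s t N by (auto simp: Q_def)
      moreover have "(s, t) \<in> r \<or> (t, s) \<in> r"
        using rays_through_comparable[of s t] s t N sub by (auto simp: Q_def)
      ultimately have "(t, s) \<in> r \<or> s = t" using min by blast
      then have "A n \<subseteq> A N" using rays_through_mono N s by auto
      then show ?thesis using sub by simp
    qed
    then show ?thesis by blast
  qed
qed

text \<open>Distinct nodes of an antichain lie on no common ray, so each antichain yields a class of
  disjoint node sets.\<close>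

lemma sigma_disjoint_node_family:
  assumes "special_tree r"
  shows "sigma_disjoint node_family"
proof -
  obtain \<C> where \<C>: "countable \<C>" "\<And>A. A \<in> \<C> \<Longrightarrow> antichain_in r A" "\<Union>\<C> = Field r"
    using assms by (auto simp: special_tree_def)
  have "pairwise disjnt (rays_through ` A)" if "A \<in> \<C>" for A
    unfolding pairwise_def disjnt_def
  proof (intro ballI impI)
    fix B B'
    assume "B \<in> rays_through ` A" "B' \<in> rays_through ` A" and ne: "B \<noteq> B'"
    then obtain s t where st: "s \<in> A" "t \<in> A" "B = rays_through s" "B' = rays_through t" by auto
    have "s \<in> Field r" "t \<in> Field r" "(s, t) \<notin> r" "(t, s) \<notin> r"
      using \<C>(2)[OF that] st ne by (auto simp: antichain_in_def)
    then show "B \<inter> B' = {}" using rays_through_comparable[of s t] st by auto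
  qed
  then show ?thesis
    unfolding sigma_disjoint_def node_family_def
    using \<C>(1) by (intro exI[of _ "(`) rays_through ` \<C>"]) (auto simp flip: \<C>(3))
qed

lemma hereditarily_complete_node_family:
  assumes onto: "f ` topspace X = topspace (ray_space r)"
  shows "hereditarily_complete X node_family"
  unfolding hereditarily_complete_def complete_family_def
proof (intro allI impI)
  fix Y \<C>
  assume Y: "closedin X Y"
    and \<C>: "\<C> \<subseteq> (\<lambda>A. A \<inter> Y) ` node_family \<and> \<C> \<noteq> {} \<and> centered_family \<C>"
  have po: "refl_on (Field r) r" "trans r" "antisym r"
    using tree by (auto simp: is_tree_def order_on_defs)
  \<comment> \<open>Different nodes may leave the same trace on \<open>Y\<close>; all of them are
    collected, and \<open>P\<close> is their downward closure.\<close>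
  define S where "S = {t \<in> Field r. rays_through t \<inter> Y \<in> \<C>}"
  have \<C>_S: "\<C> = (\<lambda>t. rays_through t \<inter> Y) ` S"
    using \<C> by (auto simp: S_def node_family_def)
  have "S \<noteq> {}" using \<C> \<C>_S by auto
  have meet: "rays_through s \<inter> rays_through t \<inter> Y \<noteq> {}" if "s \<in> S" "t \<in> S" for s t
  proof -
    have "\<Inter>{rays_through s \<inter> Y, rays_through t \<inter> Y} \<noteq> {}"
      using conjunct2[OF conjunct2[OF \<C>]] that unfolding centered_family_def S_def
      by (elim allE[of _ "{rays_through s \<inter> Y, rays_through t \<inter> Y}"]) simp
    then show ?thesis by auto
  qed
  have chain: "(s, t) \<in> r \<or> (t, s) \<in> r" if "s \<in> S" "t \<in> S" for s t
    using meet[OF that] rays_through_comparable[of s t] that by (auto simp: S_def)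
  define P where "P = {u. \<exists>s\<in>S. (u, s) \<in> r}"
  have SP: "S \<subseteq> P" using po(1) by (auto simp: P_def S_def refl_on_def)
  have PF: "P \<subseteq> Field r" by (auto simp: P_def intro: FieldI1)
  \<comment> \<open>A nonempty trace of a node above all of \<open>S\<close> lies in every member of
    \<open>\<C>\<close>, so it suffices to find such a node.\<close>
  have above: "\<Inter>\<C> \<noteq> {}" if "rays_through u \<inter> Y \<noteq> {}" "\<And>s. s \<in> S \<Longrightarrow> (s, u) \<in> r" for u
    using that rays_through_mono unfolding \<C>_S by blast
  have bound: "\<exists>s\<in>S. \<forall>u\<in>F. (u, s) \<in> r" if "finite F" "F \<subseteq> P" for F
    using that
  proof (induction F rule: finite_induct)
    case empty
    then show ?case using \<open>S \<noteq> {}\<close> by auto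
  next
    case (insert u F)
    then obtain s s' where "s \<in> S" "\<forall>u\<in>F. (u, s) \<in> r" "s' \<in> S" "(u, s') \<in> r"
      by (auto simp: P_def)
    then show ?case using chain[of s s'] po(2) unfolding trans_def by blast
  qed
  have path: "tree_path r P"
  proof -
    have "P \<in> Chains r"
      unfolding Chains_def
    proof safe
      fix a b assume ab: "a \<in> P" "b \<in> P" "(b, a) \<notin> r"
      then obtain s where s: "s \<in> S" "(a, s) \<in> r" "(b, s) \<in> r"
        using bound[of "{a, b}"] by auto
      show "(a, b) \<in> r"
      \<comment> \<open>Both nodes lie below \<open>s\<close>, and the strict predecessors of
        \<open>s\<close> are linearly ordered; equality with \<open>s\<close> is treated
        apart.\<close>
      proof (cases "a = s \<or> b = s")
        case True
        then show ?thesis using s ab by auto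
      next
        case False
        have "s \<in> Field r" using s by (auto simp: S_def)
        then have "total_on (underS r s) (Restr r (underS r s))"
          using tree by (auto simp: is_tree_def order_on_defs)
        moreover have "a \<in> underS r s" "b \<in> underS r s"
          using False s by (auto simp: underS_def)
        moreover have "(a, a) \<in> r" using ab(1) PF po(1) by (auto simp: refl_on_def)
        ultimately show ?thesis using ab(3) unfolding total_on_def by (cases "a = b") auto
      qed
    qed
    moreover have "under r t \<subseteq> P" if "t \<in> P" for t
      using that po(2) unfolding P_def under_def trans_def by blast
    ultimately show ?thesis using \<open>S \<noteq> {}\<close> SP by (auto simp: tree_path_def)
  qed
  show "\<Inter>\<C> \<noteq> {}"
  proof (cases "tree_ray r P")
    case False
    then obtain m where m: "m \<in> P" "\<And>s. s \<in> P \<Longrightarrow> (m, s) \<in> r \<Longrightarrow> s = m"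
      using path by (auto simp: tree_ray_def)
    obtain s where "s \<in> S" "(m, s) \<in> r" using m(1) by (auto simp: P_def)
    then have "m \<in> S" using m(2)[of s] SP by blast
    show ?thesis
    proof (rule above)
      show "rays_through m \<inter> Y \<noteq> {}" using meet[OF \<open>m \<in> S\<close> \<open>m \<in> S\<close>] by auto
      show "(s, m) \<in> r" if "s \<in> S" for s
        using chain[OF that \<open>m \<in> S\<close>] m(2)[of s] SP that by auto
    qed
  next
    case True
    then have "ray_fun r P \<in> f ` topspace X"
      by (simp add: onto topspace_ray_space)
    then obtain x where x: "x \<in> topspace X" "f x = ray_fun r P" by auto
    show ?thesis
    proof (cases "x \<in> Y")
      case True
      then have "x \<in> rays_through s \<inter> Y" if "s \<in> S" for s
        using that x SP PF by (auto simp: rays_through_def)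
      then show ?thesis unfolding \<C>_S by blast
    next
      \<comment> \<open>A basic box around \<open>f x\<close> contains no ray of a point of
        \<open>Y\<close>; its finitely many restricted coordinates form \<open>F\<close>.\<close>
      case False
      have "openin X (topspace X - Y)" using Y by blast
      then have "openin (ray_space r) (f ` (topspace X - Y))"
        using homeomorphic_map_openness[OF hom, of "topspace X - Y"] onto by auto
      then obtain V where
        V: "openin (product_topology (\<lambda>_. discrete_topology (UNIV :: bool set)) (Field r)) V"
        "f ` (topspace X - Y) = V \<inter> ray_fun r ` {P. tree_ray r P}"
        by (auto simp: ray_space_def openin_subtopology)
      have "f x \<in> V" using V(2) x(1) False by blast
      then obtain U where U: "finite {i \<in> Field r. U i \<noteq> UNIV}" "f x \<in> Pi\<^sub>E (Field r) U"
        "Pi\<^sub>E (Field r) U \<subseteq> V"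
        using V(1) unfolding openin_product_topology_alt by auto
      define F where "F = {i \<in> Field r. U i \<noteq> UNIV}"
      \<comment> \<open>A ray through \<open>t\<^sub>0\<close> contains all of
        \<open>F \<inter> P\<close>, as the ray \<open>P\<close> does, so it can leave the box only
        at a node outside \<open>P\<close>.\<close>
      obtain t\<^sub>0 where t\<^sub>0: "t\<^sub>0 \<in> S" "\<And>u. u \<in> F \<inter> P \<Longrightarrow> (u, t\<^sub>0) \<in> r"
        using bound[of "F \<inter> P"] U(1) unfolding F_def by auto
      \<comment> \<open>The witness is the coordinate at which the ray of a point of
        \<open>Y\<close> through \<open>s\<close> leaves the box.\<close>
      have leave: "\<exists>i\<in>F - P. rays_through i \<inter> Y \<noteq> {} \<and> (s, i) \<in> r"
        if s: "s \<in> S" "(t\<^sub>0, s) \<in> r" for s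
      proof -
        obtain y where y: "y \<in> Y" "y \<in> topspace X" "f y s"
          using meet[OF s(1) s(1)] by (auto simp: rays_through_def)
        have "f y \<notin> f ` (topspace X - Y)"
          using y homeomorphic_imp_injective_map[OF hom] by (auto simp: inj_on_def)
        then have "f y \<notin> V" using V(2) f_in[OF y(2)] by (auto simp: topspace_ray_space)
        then have "f y \<notin> Pi\<^sub>E (Field r) U" using U(3) by blast
        moreover have "f y \<in> extensional (Field r)"
          using f_in[OF y(2)] by (auto simp: topspace_ray_space)
        ultimately obtain i where i: "i \<in> Field r" "f y i \<notin> U i"
          by (auto simp: PiE_def Pi_iff)
        then have iF: "i \<in> F" by (auto simp: F_def)
        have xi: "f x i \<in> U i" using U(2) i(1) by auto
        have "i \<notin> P"
        proof
          assume "i \<in> P"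
          then have "(i, s) \<in> r" using t\<^sub>0(2) iF s(2) po(2) unfolding trans_def by blast
          then have "f y i" using ray_down[OF f_in[OF y(2)]] y(3) by blast
          moreover have "f x i" using \<open>i \<in> P\<close> i(1) x(2) by simp
          ultimately show False using xi i(2) by simp
        qed
        \<comment> \<open>The ray of \<open>x\<close> avoids \<open>i\<close>, so a disagreement
          there means that the ray of \<open>y\<close> contains \<open>i\<close>; as
          \<open>P\<close> is downward closed, \<open>i\<close> cannot lie below
          \<open>s\<close>.\<close>
        moreover from this have "f y i" using xi i x(2) by (cases "f y i") auto
        moreover have "(s, i) \<in> r \<or> (i, s) \<in> r"
          using ray_comparable[OF f_in[OF y(2)], of s i] s(1) i(1) y(3) \<open>f y i\<close>
          by (auto simp: S_def)
        ultimately show ?thesis using iF y s(1) by (auto simp: P_def rays_through_def)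
      qed
      \<comment> \<open>Pigeonhole: the node given by \<open>leave\<close> varies with
        \<open>s\<close>, but \<open>F - P\<close> is finite. If each candidate \<open>i\<close>
        failed at some \<open>h i\<close>, a common bound of \<open>t\<^sub>0\<close> and all
        \<open>h i\<close> would have no candidate above it.\<close>
      have "\<exists>i\<in>F - P. rays_through i \<inter> Y \<noteq> {} \<and> (\<forall>s\<in>S. (s, i) \<in> r)"
      proof (rule ccontr)
        assume "\<not> ?thesis"
        then have "\<exists>h. \<forall>i \<in> {i \<in> F - P. rays_through i \<inter> Y \<noteq> {}}. h i \<in> S \<and> (h i, i) \<notin> r"
          by (intro bchoice) blast
        then obtain h where
          h: "\<And>i. i \<in> F - P \<Longrightarrow> rays_through i \<inter> Y \<noteq> {} \<Longrightarrow> h i \<in> S \<and> (h i, i) \<notin> r"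
          by blast
        define H where "H = h ` {i \<in> F - P. rays_through i \<inter> Y \<noteq> {}}"
        have "finite F" using U(1) by (simp add: F_def)
        then have "finite (insert t\<^sub>0 H)" by (simp add: H_def)
        moreover have "insert t\<^sub>0 H \<subseteq> P" using h SP t\<^sub>0(1) by (auto simp: H_def)
        ultimately obtain s where s: "s \<in> S" "\<And>u. u \<in> insert t\<^sub>0 H \<Longrightarrow> (u, s) \<in> r"
          using bound[of "insert t\<^sub>0 H"] by auto
        obtain i where i: "i \<in> F - P" "rays_through i \<inter> Y \<noteq> {}" "(s, i) \<in> r"
          using leave[of s] s by blast
        have "(h i, s) \<in> r" using i by (intro s(2)) (auto simp: H_def)
        then show False using h[OF i(1,2)] i(3) po(2) unfolding trans_def by blast
      qed
      then show ?thesis using above by blast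
    qed
  qed
qed

end

section \<open>The tree of a nested noetherian clopen subbase\<close>

locale nested_noetherian_subbase =
  fixes X :: "'a topology" and \<A> :: "'a set set"
  assumes haus: "Hausdorff_space X"
    and subbase: "clopen_subbase X \<A>"
    and nested: "nested_family \<A>"
    and noetherian: "noetherian_family \<A>"
begin

text \<open>The whole space becomes the root. The empty set is dropped because it would lie above
  disjoint members, which are incomparable; it returns, as the root, only when the space is
  empty.\<close>

definition members :: "'a set set" where
  "members = insert (topspace X) (\<A> - {{}})"

definition least_at :: "'a set \<Rightarrow> bool" where
  "least_at A \<longleftrightarrow> (\<exists>x\<in>topspace X. x \<in> A \<and> (\<forall>B\<in>members. x \<in> B \<longrightarrow> A \<subseteq> B))"

text \<open>A point whose members of the subbase have a least element \<open>A\<close> would give a path with a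
  maximal node, so \<open>A\<close> is replaced by an infinite chain.\<close>

definition nodes :: "('a set \<times> nat) set" where
  "nodes = {p. fst p \<in> members \<and> (snd p = 0 \<or> least_at (fst p))}"

definition node_order :: "('a set \<times> nat) rel" where
  "node_order = {(p, q). p \<in> nodes \<and> q \<in> nodes \<and>
     (fst q \<subset> fst p \<or> fst p = fst q \<and> snd p \<le> snd q)}"

definition nodes_at :: "'a \<Rightarrow> ('a set \<times> nat) set" where
  "nodes_at x = {p \<in> nodes. x \<in> fst p}"

definition point_ray :: "'a \<Rightarrow> 'a set \<times> nat \<Rightarrow> bool" where
  "point_ray x = ray_fun node_order (nodes_at x)"

section \<open>The ordered set of nodes is a tree\<close>

lemma Field_node_order: "Field node_order = nodes"
proof
  show "Field node_order \<subseteq> nodes" by (auto simp: Field_def node_order_def)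
  show "nodes \<subseteq> Field node_order"
    by (rule subsetI, rule FieldI1) (auto simp: node_order_def)
qed

lemma members_clopen: "A \<in> members \<Longrightarrow> openin X A \<and> closedin X A"
proof -
  assume "A \<in> members"
  moreover have "\<forall>A\<in>\<A>. openin X A \<and> closedin X A"
    using subbase unfolding clopen_subbase_def by (rule conjunct1)
  ultimately show ?thesis by (auto simp: members_def)
qed

lemma members_subset: "A \<in> members \<Longrightarrow> A \<subseteq> topspace X"
  using openin_subset[of X A] members_clopen[of A] by simp

lemma members_nested:
  assumes "A \<in> members" "B \<in> members" "A \<inter> B \<noteq> {}"
  shows "A \<subseteq> B \<or> B \<subseteq> A"
proof (cases "A = topspace X \<or> B = topspace X")
  case True
  then show ?thesis using members_subset[OF assms(1)] members_subset[OF assms(2)] by auto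
next
  case False
  then have "A \<in> \<A>" "B \<in> \<A>" using assms by (auto simp: members_def)
  then show ?thesis using nested assms(3) by (simp add: nested_family_def)
qed

lemma node_order_fst: "(p, q) \<in> node_order \<Longrightarrow> fst q \<subseteq> fst p"
  by (auto simp: node_order_def)

text \<open>Nestedness compares members that meet, and the numbers compare copies of one member.
  Equal first components are a separate alternative because the root is empty when the space
  is.\<close>

lemma nodes_comparable:
  assumes "p \<in> nodes" "q \<in> nodes" "fst p \<inter> fst q \<noteq> {} \<or> fst p = fst q"
  shows "(p, q) \<in> node_order \<or> (q, p) \<in> node_order"
proof -
  have "fst p \<in> members" "fst q \<in> members" using assms by (auto simp: nodes_def)
  then have "fst p \<subset> fst q \<or> fst q \<subset> fst p \<or> fst p = fst q"
    using members_nested assms(3) by blast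
  then show ?thesis using assms(1,2) nat_le_linear[of "snd p" "snd q"]
    unfolding node_order_def by auto
qed

text \<open>An infinite descent is a strictly increasing sequence of members. None of them is the
  whole space, since a larger one follows, so the sequence lies in \<open>\<A>\<close> and
  contradicts noetherianness.\<close>

lemma wf_members: "wf {(A, B). A \<in> members \<and> B \<in> members \<and> B \<subset> A}"
  unfolding wf_iff_no_infinite_down_chain
proof
  assume "\<exists>S. \<forall>i. (S (Suc i), S i) \<in> {(A, B). A \<in> members \<and> B \<in> members \<and> B \<subset> A}"
  then obtain S where
    step: "\<forall>i. (S (Suc i), S i) \<in> {(A, B). A \<in> members \<and> B \<in> members \<and> B \<subset> A}"
    by (rule exE)
  have S: "S i \<in> members" "S i \<subset> S (Suc i)" for i using step[rule_format, of i] by simp_all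
  have "S i \<noteq> topspace X" for i using S(2)[of i] members_subset[OF S(1)[of "Suc i"]] by auto
  then have "S i \<in> \<A>" for i using S(1)[of i] by (auto simp: members_def)
  moreover have "incseq S" by (rule incseq_SucI) (rule psubset_imp_subset[OF S(2)])
  ultimately have "\<exists>N. \<forall>n\<ge>N. S n = S N"
    using noetherian[unfolded noetherian_family_def, rule_format, of S] by blast
  then obtain N where N: "\<forall>n\<ge>N. S n = S N" by (rule exE)
  have "S (Suc N) = S N" by (rule N[rule_format]) simp
  then show False using S(2)[of N] by simp
qed

lemma wf_node_order: "wf (node_order - Id)"
proof (rule wf_subset)
  show "wf ({(A, B). A \<in> members \<and> B \<in> members \<and> B \<subset> A} <*lex*> less_than)"
    by (intro wf_lex_prod wf_members wf_less_than)
  show "node_order - Id \<subseteq> {(A, B). A \<in> members \<and> B \<in> members \<and> B \<subset> A} <*lex*> less_than"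
    by (auto simp: node_order_def nodes_def)
qed

lemma partial_order_node_order:
  "refl_on nodes node_order" "trans node_order" "antisym node_order" "node_order \<subseteq> nodes \<times> nodes"
proof -
  show "refl_on nodes node_order" by (auto simp: refl_on_def node_order_def)
  show "trans node_order" by (rule transI) (auto simp: node_order_def)
  show "antisym node_order" by (rule antisymI) (auto simp: node_order_def)
  show "node_order \<subseteq> nodes \<times> nodes" by (auto simp: node_order_def)
qed

lemma root_node: "(topspace X, 0) \<in> nodes"
  by (auto simp: nodes_def members_def)

lemma root_below: "p \<in> nodes \<Longrightarrow> ((topspace X, 0), p) \<in> node_order"
  using root_node members_subset[of "fst p"] by (auto simp: node_order_def nodes_def)

text \<open>The predecessors of a node \<open>t\<close> have first components containing
  \<open>fst t\<close>, so these meet and the predecessors are comparable; well-foundedness is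
  inherited from the whole order.\<close>

lemma is_tree_node_order: "is_tree node_order"
proof -
  have "Partial_order node_order"
    using partial_order_node_order by (simp add: Field_node_order order_on_defs)
  moreover have "\<exists>!m. m \<in> nodes \<and> (\<forall>s. (s, m) \<in> node_order \<longrightarrow> s = m)"
  proof (rule ex1I[of _ "(topspace X, 0)"])
    have "s = (topspace X, 0)" if s: "(s, (topspace X, 0)) \<in> node_order" for s
    proof -
      have "s \<in> nodes" using s partial_order_node_order(4) by blast
      then show ?thesis using root_below s partial_order_node_order(3) by (meson antisymD)
    qed
    then show "(topspace X, 0) \<in> nodes \<and>
        (\<forall>s. (s, (topspace X, 0)) \<in> node_order \<longrightarrow> s = (topspace X, 0))"
      using root_node by blast
    show "m = (topspace X, 0)" if "m \<in> nodes \<and> (\<forall>s. (s, m) \<in> node_order \<longrightarrow> s = m)" for m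
      using that root_below[of m] by metis
  qed
  moreover have "well_order_on (underS node_order t) (Restr node_order (underS node_order t))"
    if t: "t \<in> nodes" for t
  proof -
    let ?U = "underS node_order t"
    have U: "?U \<subseteq> nodes" using partial_order_node_order(4) by (auto simp: underS_def)
    have "(a, b) \<in> node_order \<or> (b, a) \<in> node_order" if ab: "a \<in> ?U" "b \<in> ?U" for a b
    proof (rule nodes_comparable)
      show nab: "a \<in> nodes" "b \<in> nodes" using ab U by auto
      have sub: "fst t \<subseteq> fst a" "fst t \<subseteq> fst b"
        using ab node_order_fst by (auto simp: underS_def)
      show "fst a \<inter> fst b \<noteq> {} \<or> fst a = fst b"
      proof (cases "fst t = {}")
        \<comment> \<open>Only the empty space has an empty member; all first components are then
          empty and equal.\<close>
        case True
        then have "topspace X = {}" using t by (auto simp: nodes_def members_def)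
        moreover have "fst a \<subseteq> topspace X" "fst b \<subseteq> topspace X"
          using members_subset nab by (auto simp: nodes_def)
        ultimately show ?thesis by auto
      next
        case False
        then show ?thesis using sub by blast
      qed
    qed
    then have "total_on ?U (Restr node_order ?U)" by (auto simp: total_on_def)
    moreover have "refl_on ?U (Restr node_order ?U)"
      using partial_order_node_order(1) U by (auto simp: refl_on_def)
    moreover have "trans (Restr node_order ?U)"
      using partial_order_node_order(2) by (rule trans_Restr)
    moreover have "antisym (Restr node_order ?U)"
      using partial_order_node_order(3) by (rule antisym_subset[rotated]) blast
    moreover have "wf (Restr node_order ?U - Id)"
      using wf_node_order by (rule wf_subset) blast
    ultimately show ?thesis by (simp add: order_on_defs)
  qed
  ultimately show ?thesis by (simp add: is_tree_def Field_node_order)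
qed

text \<open>Within a disjoint class of nonempty members inclusion is equality, so fixing the class
  and the number leaves an antichain. The whole space forms its own class because it may not belong
  to \<open>\<A>\<close>.\<close>

lemma special_tree_node_order:
  assumes "sigma_disjoint \<A>"
  shows "special_tree node_order"
proof -
  obtain \<DD> where \<DD>: "countable \<DD>" "\<And>\<D>. \<D> \<in> \<DD> \<Longrightarrow> pairwise disjnt \<D>" "\<Union>\<DD> = \<A>"
    using assms by (auto simp: sigma_disjoint_def)
  define level where "level = (\<lambda>(\<D>, n::nat). {p \<in> nodes. fst p \<in> \<D> \<and> snd p = n})"
  define \<C> where "\<C> = level ` (insert {topspace X} ((\<lambda>\<D>. \<D> - {{}}) ` \<DD>) \<times> UNIV)"
  have "countable \<C>" unfolding \<C>_def using \<DD>(1) by simp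
  moreover have "antichain_in node_order C" if C: "C \<in> \<C>" for C
  proof -
    obtain d where d: "d \<in> insert {topspace X} ((\<lambda>\<D>. \<D> - {{}}) ` \<DD>) \<times> UNIV" "C = level d"
      using C unfolding \<C>_def by blast
    obtain \<D> n where "d = (\<D>, n)" by (cases d)
    then have D: "\<D> = {topspace X} \<or> (\<exists>\<D>'\<in>\<DD>. \<D> = \<D>' - {{}})" "C = level (\<D>, n)"
      using d by auto
    have disj: "A = B" if "A \<in> \<D>" "B \<in> \<D>" "A \<subseteq> B" for A B
      using D(1)
    proof
      assume "\<D> = {topspace X}"
      then show ?thesis using that by simp
    next
      assume "\<exists>\<D>'\<in>\<DD>. \<D> = \<D>' - {{}}"
      then obtain \<D>' where D': "\<D>' \<in> \<DD>" "\<D> = \<D>' - {{}}" by blast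
      then have AB: "A \<noteq> {}" "A \<in> \<D>'" "B \<in> \<D>'" using that by auto
      show ?thesis
      proof (rule ccontr)
        assume "A \<noteq> B"
        then have "A \<inter> B = {}"
          using pairwiseD[OF \<DD>(2)[OF D'(1)] AB(2,3)] by (simp add: disjnt_def)
        then show False using that(3) AB(1) by blast
      qed
    qed
    show ?thesis
      unfolding antichain_in_def Field_node_order D(2)
    proof (intro conjI ballI impI)
      show "level (\<D>, n) \<subseteq> nodes" by (auto simp: level_def)
      fix s t
      assume "s \<in> level (\<D>, n)" "t \<in> level (\<D>, n)" "(s, t) \<in> node_order"
      then show "s = t"
        using disj[of "fst t" "fst s"] node_order_fst[of s t] by (auto simp: level_def prod_eq_iff)
    qed
  qed
  moreover have "\<Union>\<C> = nodes"
  proof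
    show "\<Union>\<C> \<subseteq> nodes" by (auto simp: \<C>_def level_def)
    show "nodes \<subseteq> \<Union>\<C>"
    proof
      fix p assume p: "p \<in> nodes"
      then have "\<exists>\<D>\<in>insert {topspace X} ((\<lambda>\<D>. \<D> - {{}}) ` \<DD>). fst p \<in> \<D>"
        using \<DD>(3) by (auto simp: nodes_def members_def)
      then obtain \<D> where "\<D> \<in> insert {topspace X} ((\<lambda>\<D>. \<D> - {{}}) ` \<DD>)" "fst p \<in> \<D>" by blast
      then have "level (\<D>, snd p) \<in> \<C>" unfolding \<C>_def by blast
      moreover have "p \<in> level (\<D>, snd p)"
        using p \<open>fst p \<in> \<D>\<close> by (simp add: level_def)
      ultimately show "p \<in> \<Union>\<C>" by blast
    qed
  qed
  ultimately show ?thesis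
    using is_tree_node_order unfolding special_tree_def Field_node_order by blast
qed

lemma tree_ray_nodes_at:
  assumes x: "x \<in> topspace X"
  shows "tree_ray node_order (nodes_at x)"
proof -
  have ne: "nodes_at x \<noteq> {}" using root_node x by (auto simp: nodes_at_def)
  have chain: "nodes_at x \<in> Chains node_order"
    unfolding Chains_def
  proof (intro CollectI ballI)
    fix p q assume "p \<in> nodes_at x" "q \<in> nodes_at x"
    then show "(p, q) \<in> node_order \<or> (q, p) \<in> node_order"
      by (intro nodes_comparable) (auto simp: nodes_at_def)
  qed
  have down: "under node_order t \<subseteq> nodes_at x" if "t \<in> nodes_at x" for t
  proof
    fix s assume "s \<in> under node_order t"
    then have st: "(s, t) \<in> node_order" by (simp add: under_def)
    then have "s \<in> nodes" using partial_order_node_order(4) by blast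
    then show "s \<in> nodes_at x" using node_order_fst[OF st] that by (auto simp: nodes_at_def)
  qed
  \<comment> \<open>A member around \<open>x\<close> that does not include \<open>fst m\<close> is
    strictly smaller and gives a higher node; otherwise \<open>fst m\<close> is the least member at
    \<open>x\<close>, and its next copy is a node.\<close>
  have no_max: False if m: "m \<in> nodes_at x" and max: "\<forall>s\<in>nodes_at x. (m, s) \<in> node_order \<longrightarrow> s = m" for m
  proof (cases "\<exists>B\<in>members. x \<in> B \<and> \<not> fst m \<subseteq> B")
    case True
    then obtain B where B: "B \<in> members" "x \<in> B" "\<not> fst m \<subseteq> B" by blast
    then have sub: "B \<subset> fst m"
      using members_nested[of B "fst m"] m by (auto simp: nodes_at_def nodes_def)
    then have "(B, 0) \<in> nodes_at x" "(m, (B, 0)) \<in> node_order"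
      using B m by (auto simp: nodes_at_def nodes_def node_order_def)
    then have "(B, 0) = m" using max by blast
    then show False using sub by auto
  next
    case False
    then have "least_at (fst m)" using x m by (auto simp: least_at_def nodes_at_def)
    then have "(fst m, Suc (snd m)) \<in> nodes_at x" "(m, (fst m, Suc (snd m))) \<in> node_order"
      using m by (auto simp: nodes_at_def nodes_def node_order_def)
    then have "(fst m, Suc (snd m)) = m" using max by blast
    then show False by (metis n_not_Suc_n snd_conv)
  qed
  have "\<not> (\<exists>m\<in>nodes_at x. \<forall>s\<in>nodes_at x. (m, s) \<in> node_order \<longrightarrow> s = m)"
    using no_max by (intro notI) (elim bexE)
  then show ?thesis unfolding tree_ray_def tree_path_def using ne chain down by simp
qed

section \<open>The map from points to rays is an embedding\<close>

lemma point_ray_in: "x \<in> topspace X \<Longrightarrow> point_ray x \<in> topspace (ray_space node_order)"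
  using tree_ray_nodes_at by (auto simp: point_ray_def topspace_ray_space)

lemma point_ray_node: "t \<in> nodes \<Longrightarrow> point_ray x t \<longleftrightarrow> x \<in> fst t"
  by (simp add: point_ray_def Field_node_order nodes_at_def)

lemma continuous_point_ray: "continuous_map X (ray_space node_order) point_ray"
  unfolding continuous_map_ray_space Field_node_order
proof (intro conjI ballI)
  show "point_ray \<in> topspace X \<rightarrow> topspace (ray_space node_order)" using point_ray_in by blast
  fix t assume t: "t \<in> nodes"
  then have mem: "fst t \<in> members" by (simp add: nodes_def)
  have eq: "{x \<in> topspace X. point_ray x t} = fst t"
    using members_subset[OF mem] t by (auto simp: point_ray_node)
  show "openin X {x \<in> topspace X. point_ray x t}" "closedin X {x \<in> topspace X. point_ray x t}"
    unfolding eq using members_clopen[OF mem] by auto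
qed

text \<open>The initial topology of \<open>point_ray\<close>, formed by the preimages of open sets,
  makes every set of the subbase clopen, so by minimality of the topology of \<open>X\<close> it
  contains all open sets of \<open>X\<close>.\<close>

lemma openin_point_ray_vimage:
  assumes "openin X U"
  obtains V where "openin (ray_space node_order) V" "U = point_ray -` V \<inter> topspace X"
proof -
  let ?Y = "pullback_topology (topspace X) point_ray (ray_space node_order)"
  have top: "topspace ?Y = topspace X"
    using point_ray_in by (auto simp: topspace_pullback_topology)
  have "continuous_map ?Y (ray_space node_order) (id \<circ> point_ray)"
    by (rule continuous_map_pullback) simp
  then have clopen: "openin ?Y {x \<in> topspace X. point_ray x t} \<and>
      closedin ?Y {x \<in> topspace X. point_ray x t}" if "t \<in> nodes" for t
    using that by (simp add: continuous_map_ray_space Field_node_order top)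
  have "openin ?Y A \<and> closedin ?Y A" if A: "A \<in> \<A>" for A
  proof (cases "A = {}")
    case False
    then have mem: "A \<in> members" using A by (simp add: members_def)
    then have "(A, 0) \<in> nodes" by (simp add: nodes_def)
    moreover from this have "{x \<in> topspace X. point_ray x (A, 0)} = A"
      using members_subset[OF mem] by (auto simp: point_ray_node)
    ultimately show ?thesis using clopen[of "(A, 0)"] by simp
  qed auto
  then have "openin ?Y U"
    using conjunct2[OF subbase[unfolded clopen_subbase_def]] assms top by blast
  then show ?thesis using that by (auto simp: openin_pullback_topology)
qed

lemma embedding_point_ray: "embedding_map X (ray_space node_order) point_ray"
  unfolding embedding_map_def
proof (rule bijective_open_imp_homeomorphic_map)
  let ?Z = "subtopology (ray_space node_order) (point_ray ` topspace X)"
  show "continuous_map X ?Z point_ray"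
    using continuous_point_ray by (simp add: continuous_map_in_subtopology)
  show "point_ray ` topspace X = topspace ?Z" using point_ray_in by auto
  show "open_map X ?Z point_ray"
    unfolding open_map_def
  proof (intro allI impI)
    fix U assume "openin X U"
    then obtain V where V: "openin (ray_space node_order) V" "U = point_ray -` V \<inter> topspace X"
      by (rule openin_point_ray_vimage)
    then have "point_ray ` U = V \<inter> point_ray ` topspace X" by auto
    then show "openin ?Z (point_ray ` U)" using V(1) by (auto simp: openin_subtopology)
  qed
  \<comment> \<open>Open sets are preimages under \<open>point_ray\<close>, so points with the same
    ray cannot be separated by them, against the Hausdorff property.\<close>
  show "inj_on point_ray (topspace X)"
  proof (rule inj_onI, rule ccontr)
    fix x y assume xy: "x \<in> topspace X" "y \<in> topspace X" "point_ray x = point_ray y" "x \<noteq> y"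
    then obtain U W where U: "openin X U" "x \<in> U" "y \<in> W" "disjnt U W"
      using haus by (auto simp: Hausdorff_space_def) metis
    obtain V where "U = point_ray -` V \<inter> topspace X" using openin_point_ray_vimage[OF U(1)] by blast
    then have "y \<in> U" using U(2) xy by auto
    then show False using U by (auto simp: disjnt_def)
  qed
qed

text \<open>If no point realised \<open>C\<close>, each point of \<open>\<Inter>C\<close> would lie
  in a member outside \<open>C\<close>, which by nestedness and upward closure is contained in
  \<open>\<Inter>C\<close>. The complement of \<open>\<Inter>C\<close> is then closed, and the
  traces of \<open>C\<close> on it are centered with empty intersection, against hereditary
  completeness.\<close>

lemma ray_point_of_chain:
  assumes hc: "hereditarily_complete X \<A>"
    and C: "C \<subseteq> members" "C \<noteq> {}"
    and chain: "\<And>A B. A \<in> C \<Longrightarrow> B \<in> C \<Longrightarrow> A \<subseteq> B \<or> B \<subseteq> A"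
    and up: "\<And>A B. A \<in> C \<Longrightarrow> B \<in> members \<Longrightarrow> A \<subseteq> B \<Longrightarrow> B \<in> C"
    and no_least: "\<And>A. A \<in> C \<Longrightarrow> \<exists>B\<in>C. B \<subset> A"
  shows "\<exists>x\<in>topspace X. \<forall>B\<in>members. x \<in> B \<longleftrightarrow> B \<in> C"
proof (rule ccontr)
  assume none: "\<not> ?thesis"
  have ZX: "\<Inter>C \<subseteq> topspace X" using C members_subset by blast
  have "openin X (\<Inter>C)"
  proof (subst openin_subopen, rule ballI)
    fix x assume x: "x \<in> \<Inter>C"
    then have "x \<in> topspace X" using ZX by blast
    then obtain B where B: "B \<in> members" "x \<in> B" "B \<notin> C" using none x by blast
    have "B \<subseteq> A" if "A \<in> C" for A
      using members_nested[of A B] up[of A B] that B x C(1) by blast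
    then show "\<exists>T. openin X T \<and> x \<in> T \<and> T \<subseteq> \<Inter>C" using B members_clopen by blast
  qed
  define Y where "Y = topspace X - \<Inter>C"
  have "closedin X Y" using \<open>openin X (\<Inter>C)\<close> by (simp add: Y_def closedin_diff)
  \<comment> \<open>The whole space is left out because it may not belong to \<open>\<A>\<close>;
    since \<open>C\<close> has no least element, something remains.\<close>
  define D where "D = (\<lambda>A. A \<inter> Y) ` (C - {topspace X})"
  have CA: "C - {topspace X} \<subseteq> \<A>" using C(1) by (auto simp: members_def)
  obtain A B where "A \<in> C" "B \<in> C" "B \<subset> A" using C(2) no_least by blast
  then have "B \<in> C - {topspace X}" using members_subset C(1) by blast
  then have "D \<noteq> {}" by (auto simp: D_def)
  have "centered_family D"
    unfolding centered_family_def
  proof (intro allI impI)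
    fix F assume F: "F \<subseteq> D \<and> finite F \<and> F \<noteq> {}"
    then obtain E where E: "E \<subseteq> C - {topspace X}" "finite E" "F = (\<lambda>A. A \<inter> Y) ` E"
      unfolding D_def by (meson finite_subset_image)
    then have "E \<noteq> {}" using F by auto
    \<comment> \<open>The finite chain \<open>E\<close> has a least set \<open>M\<close>; a point of
      \<open>M\<close> outside a smaller set of \<open>C\<close> lies in all of \<open>E\<close>
      and, being outside \<open>\<Inter>C\<close>, in \<open>Y\<close>.\<close>
    then obtain M where M: "M \<in> E" "\<And>A. A \<in> E \<Longrightarrow> A \<subseteq> M \<Longrightarrow> M = A"
      using finite_has_minimal[OF E(2)] by blast
    have least: "M \<subseteq> A" if "A \<in> E" for A
      using chain[of A M] M that E(1) by blast
    obtain B where B: "B \<in> C" "B \<subset> M" using no_least[of M] M(1) E(1) by blast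
    then obtain y where y: "y \<in> M" "y \<notin> B" by blast
    have "M \<subseteq> topspace X" using M(1) E(1) C(1) members_subset by blast
    then have "y \<in> Y" using y B by (auto simp: Y_def)
    then have "y \<in> \<Inter>F" using y least E(3) by auto
    then show "\<Inter>F \<noteq> {}" by blast
  qed
  moreover have "D \<subseteq> (\<lambda>A. A \<inter> Y) ` \<A>" using CA by (auto simp: D_def)
  ultimately have "\<Inter>D \<noteq> {}"
    using hc \<open>closedin X Y\<close> \<open>D \<noteq> {}\<close>
    by (simp add: hereditarily_complete_def complete_family_def)
  then obtain y where "y \<in> \<Inter>D" by blast
  then have y: "y \<in> A \<inter> Y" if "A \<in> C - {topspace X}" for A
    using that unfolding D_def by blast
  then have "y \<in> Y" using \<open>B \<in> C - {topspace X}\<close> by blast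
  then have "y \<in> A" if "A \<in> C" for A
    using y[of A] that by (cases "A = topspace X") (simp_all add: Y_def)
  then have "y \<in> \<Inter>C" by blast
  then show False using \<open>y \<in> Y\<close> by (simp add: Y_def)
qed

text \<open>The members on a ray \<open>Q\<close> form an upward closed chain \<open>C\<close>, and
  the absence of a maximal node forces \<open>Q\<close> to contain every copy of each member in
  \<open>C\<close>. So it suffices to find a point whose members are exactly
  \<open>C\<close>.\<close>

lemma surj_point_ray:
  assumes hc: "hereditarily_complete X \<A>"
  shows "point_ray ` topspace X = topspace (ray_space node_order)"
proof
  show "point_ray ` topspace X \<subseteq> topspace (ray_space node_order)" using point_ray_in by blast
  show "topspace (ray_space node_order) \<subseteq> point_ray ` topspace X"
  proof
    fix g assume "g \<in> topspace (ray_space node_order)"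
    then obtain Q where Q: "tree_ray node_order Q" "g = ray_fun node_order Q" by (rule ray_funE)
    have Q_ne: "Q \<noteq> {}"
      and Q_chain: "\<And>p q. p \<in> Q \<Longrightarrow> q \<in> Q \<Longrightarrow> (p, q) \<in> node_order \<or> (q, p) \<in> node_order"
      and Q_down: "\<And>p q. q \<in> Q \<Longrightarrow> (p, q) \<in> node_order \<Longrightarrow> p \<in> Q"
      and Q_max: "\<And>m. m \<in> Q \<Longrightarrow> \<exists>s\<in>Q. (m, s) \<in> node_order \<and> s \<noteq> m"
      using Q(1) by (auto simp: tree_ray_def tree_path_def Chains_def under_def)
    have Q_nodes: "Q \<subseteq> nodes" using Q_chain partial_order_node_order(4) by blast
    \<comment> \<open>Since \<open>(A, 0)\<close> is the lowest copy of \<open>A\<close>, it lies in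
      \<open>Q\<close> as soon as any copy does.\<close>
    define C where "C = {A. (A, 0) \<in> Q}"
    have fst_C: "fst p \<in> C" if "p \<in> Q" for p
    proof -
      have "((fst p, 0), p) \<in> node_order" using that Q_nodes by (auto simp: node_order_def nodes_def)
      then show ?thesis using Q_down[OF that] by (simp add: C_def)
    qed
    have C_members: "C \<subseteq> members" using Q_nodes by (auto simp: C_def nodes_def)
    have C_ne: "C \<noteq> {}" using Q_ne fst_C by blast
    have C_up: "B \<in> C" if "A \<in> C" "B \<in> members" "A \<subseteq> B" for A B
    proof (cases "A = B")
      case False
      then have "((B, 0), (A, 0)) \<in> node_order"
        using that C_members by (auto simp: node_order_def nodes_def)
      then show ?thesis using Q_down[of "(A, 0)"] that(1) by (auto simp: C_def)
    qed (use that in simp)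
    have C_chain: "A \<subseteq> B \<or> B \<subseteq> A" if "A \<in> C" "B \<in> C" for A B
      using Q_chain[of "(A, 0)" "(B, 0)"] that node_order_fst by (fastforce simp: C_def)
    have below: "p \<in> Q" if "p \<in> nodes" "B \<in> C" "B \<subset> fst p" for p B
    proof -
      have "(p, (B, 0)) \<in> node_order"
        using that C_members by (auto simp: node_order_def nodes_def)
      then show ?thesis using Q_down[of "(B, 0)"] that(2) by (auto simp: C_def)
    qed
    have "\<exists>x\<in>topspace X. (\<forall>B\<in>members. x \<in> B \<longleftrightarrow> B \<in> C) \<and> (\<forall>p\<in>nodes. fst p \<in> C \<longrightarrow> p \<in> Q)"
    proof (cases "\<exists>M\<in>C. \<forall>B\<in>C. M \<subseteq> B")
      case True
      then obtain M where M: "M \<in> C" "\<And>B. B \<in> C \<Longrightarrow> M \<subseteq> B" by blast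
      \<comment> \<open>A node of \<open>Q\<close> above \<open>(M, n)\<close> has first component
        \<open>M\<close>, as \<open>M\<close> is least in \<open>C\<close>, so its number is
        larger.\<close>
      have step: "\<exists>k>n. (M, k) \<in> Q" if Mn: "(M, n) \<in> Q" for n
      proof -
        obtain s where s: "s \<in> Q" "((M, n), s) \<in> node_order" "s \<noteq> (M, n)"
          using Q_max[OF Mn] by blast
        then have "fst s = M" using M(2)[OF fst_C[OF s(1)]] by (auto simp: node_order_def)
        moreover from this have "snd s > n"
          using s by (cases s) (auto simp: node_order_def)
        ultimately show ?thesis using s(1) by (metis prod.collapse)
      qed
      have "(M, 0) \<in> Q" using M(1) by (simp add: C_def)
      then obtain k where "k > 0" "(M, k) \<in> Q" using step by blast
      \<comment> \<open>A positive copy of \<open>M\<close> can be a node only if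
        \<open>least_at M\<close> holds; the point witnessing this is the one sought.\<close>
      then have "least_at M" using Q_nodes by (auto simp: nodes_def)
      then obtain x where x: "x \<in> topspace X" "x \<in> M" "\<And>B. B \<in> members \<Longrightarrow> x \<in> B \<Longrightarrow> M \<subseteq> B"
        by (auto simp: least_at_def)
      have M_nodes: "(M, n) \<in> nodes" for n
        using \<open>least_at M\<close> M(1) C_members by (auto simp: nodes_def)
      have all: "(M, n) \<in> Q" for n
      proof (induction n)
        case (Suc n)
        then obtain k where k: "k > n" "(M, k) \<in> Q" using step by blast
        then have "((M, Suc n), (M, k)) \<in> node_order" using M_nodes by (auto simp: node_order_def)
        then show ?case by (rule Q_down[OF k(2)])
      qed (rule \<open>(M, 0) \<in> Q\<close>)
      have "p \<in> Q" if "p \<in> nodes" "fst p \<in> C" for p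
      proof (cases "fst p = M")
        case True
        then show ?thesis using all[of "snd p"] by auto
      next
        case False
        then show ?thesis using below[OF that(1) M(1)] M(2)[OF that(2)] by auto
      qed
      moreover have "x \<in> B \<longleftrightarrow> B \<in> C" if "B \<in> members" for B
        using that x M C_up[OF M(1), of B] by blast
      ultimately show ?thesis using x(1) by blast
    next
      case False
      have no_least: "\<exists>B\<in>C. B \<subset> A" if A: "A \<in> C" for A
      proof -
        have "\<exists>B\<in>C. \<not> A \<subseteq> B" using False A by simp
        then obtain B where B: "B \<in> C" "\<not> A \<subseteq> B" by (rule bexE)
        then have "B \<subset> A" using C_chain[OF A B(1)] by auto
        then show ?thesis using B(1) by auto
      qed
      have "p \<in> Q" if "p \<in> nodes" "fst p \<in> C" for p
        using no_least[OF that(2)] below[OF that(1)] by auto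
      moreover have "\<exists>x\<in>topspace X. \<forall>B\<in>members. x \<in> B \<longleftrightarrow> B \<in> C"
      proof (rule ray_point_of_chain[OF hc C_members C_ne])
        show "A \<subseteq> B \<or> B \<subseteq> A" if "A \<in> C" "B \<in> C" for A B using that by (rule C_chain)
        show "B \<in> C" if "A \<in> C" "B \<in> members" "A \<subseteq> B" for A B using that by (rule C_up)
        show "\<exists>B\<in>C. B \<subset> A" if "A \<in> C" for A using that by (rule no_least)
      qed
      ultimately show ?thesis by auto
    qed
    then obtain x where x: "x \<in> topspace X" "\<forall>B\<in>members. x \<in> B \<longleftrightarrow> B \<in> C"
      "\<forall>p\<in>nodes. fst p \<in> C \<longrightarrow> p \<in> Q"
      by (elim bexE conjE)
    have "p \<in> nodes_at x \<longleftrightarrow> p \<in> Q" for p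
    proof (cases "p \<in> nodes")
      case True
      then have "x \<in> fst p \<longleftrightarrow> fst p \<in> C" using x(2) by (simp add: nodes_def)
      then show ?thesis using True x(3) fst_C[of p] by (auto simp: nodes_at_def)
    next
      case False
      then show ?thesis using Q_nodes by (auto simp: nodes_at_def)
    qed
    then have "nodes_at x = Q" by blast
    then have "g = point_ray x" using Q(2) by (simp add: point_ray_def)
    then show "g \<in> point_ray ` topspace X" using x(1) by simp
  qed
qed

end

section \<open>Representation theorem\<close>

lemma embeds_intoD:
  assumes "is_tree T" "embeds_into X (ray_space T)"
  shows "\<exists>\<A>. clopen_subbase X \<A> \<and> nested_family \<A> \<and> noetherian_family \<A> \<and>
    (special_tree T \<longrightarrow> sigma_disjoint \<A>)"
proof -
  obtain f where "embedding_map X (ray_space T) f" using assms(2) by (auto simp: embeds_into_def)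
  then interpret ray_embedding X T f by unfold_locales (rule assms(1))
  show ?thesis
    using clopen_subbase_node_family nested_node_family noetherian_node_family
      sigma_disjoint_node_family by blast
qed

lemma embeds_ontoD:
  assumes "is_tree T" "embeds_onto X (ray_space T)"
  shows "\<exists>\<A>. clopen_subbase X \<A> \<and> hereditarily_complete X \<A> \<and> nested_family \<A> \<and>
    noetherian_family \<A> \<and> (special_tree T \<longrightarrow> sigma_disjoint \<A>)"
proof -
  obtain f where f: "embedding_map X (ray_space T) f" "f ` topspace X = topspace (ray_space T)"
    using assms(2) by (auto simp: embeds_onto_def)
  interpret ray_embedding X T f by unfold_locales (rule assms(1) f(1))+
  show ?thesis
    using clopen_subbase_node_family nested_node_family noetherian_node_family
      sigma_disjoint_node_family hereditarily_complete_node_family[OF f(2)] by blast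
qed

text \<open>One tree, built from \<open>X\<close> and \<open>\<A>\<close> alone, serves all four
  parts; the implications record what it gains from further properties of the subbase.\<close>

lemma nested_noetherian_subbase_tree:
  fixes X :: "'a topology"
  assumes "Hausdorff_space X" "clopen_subbase X \<A>" "nested_family \<A>" "noetherian_family \<A>"
  shows "\<exists>T :: ('a set \<times> nat) rel. is_tree T \<and> embeds_into X (ray_space T) \<and>
    (sigma_disjoint \<A> \<longrightarrow> special_tree T) \<and>
    (hereditarily_complete X \<A> \<longrightarrow> embeds_onto X (ray_space T))"
proof -
  interpret nested_noetherian_subbase X \<A> by unfold_locales (rule assms)+
  show ?thesis
    unfolding embeds_into_def embeds_onto_def
    using is_tree_node_order embedding_point_ray special_tree_node_order surj_point_ray by blast
qed

lemma special_tree_is_tree: "special_tree T \<Longrightarrow> is_tree T"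
  by (simp add: special_tree_def)

theorem theorem3p6:
  fixes X :: "'a topology"
  assumes "Hausdorff_space X"
  shows
    "(((\<exists>T :: ('a set \<times> nat) rel. is_tree T \<and> embeds_into X (ray_space T))
        \<longleftrightarrow> (\<exists>\<A>. clopen_subbase X \<A> \<and> nested_family \<A> \<and> noetherian_family \<A>))
      \<and> ((\<exists>T :: 't rel. is_tree T \<and> embeds_into X (ray_space T))
        \<longrightarrow> (\<exists>\<A>. clopen_subbase X \<A> \<and> nested_family \<A> \<and> noetherian_family \<A>)))
    \<and>
     (((\<exists>T :: ('a set \<times> nat) rel. special_tree T \<and> embeds_into X (ray_space T))
        \<longleftrightarrow> (\<exists>\<A>. clopen_subbase X \<A> \<and> nested_family \<A> \<and> noetherian_family \<A>
                 \<and> sigma_disjoint \<A>))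
      \<and> ((\<exists>T :: 't rel. special_tree T \<and> embeds_into X (ray_space T))
        \<longrightarrow> (\<exists>\<A>. clopen_subbase X \<A> \<and> nested_family \<A> \<and> noetherian_family \<A>
                 \<and> sigma_disjoint \<A>)))
    \<and>
     (((\<exists>T :: ('a set \<times> nat) rel. is_tree T \<and> embeds_onto X (ray_space T))
        \<longleftrightarrow> (\<exists>\<A>. clopen_subbase X \<A> \<and> hereditarily_complete X \<A>
                 \<and> nested_family \<A> \<and> noetherian_family \<A>))
      \<and> ((\<exists>T :: 't rel. is_tree T \<and> embeds_onto X (ray_space T))
        \<longrightarrow> (\<exists>\<A>. clopen_subbase X \<A> \<and> hereditarily_complete X \<A>
                 \<and> nested_family \<A> \<and> noetherian_family \<A>)))
    \<and>
     (((\<exists>T :: ('a set \<times> nat) rel. special_tree T \<and> embeds_onto X (ray_space T))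
        \<longleftrightarrow> (\<exists>\<A>. clopen_subbase X \<A> \<and> hereditarily_complete X \<A>
                 \<and> nested_family \<A> \<and> noetherian_family \<A> \<and> sigma_disjoint \<A>))
      \<and> ((\<exists>T :: 't rel. special_tree T \<and> embeds_onto X (ray_space T))
        \<longrightarrow> (\<exists>\<A>. clopen_subbase X \<A> \<and> hereditarily_complete X \<A>
                 \<and> nested_family \<A> \<and> noetherian_family \<A> \<and> sigma_disjoint \<A>)))"
  (is "((?A1 \<longleftrightarrow> ?A) \<and> (?A2 \<longrightarrow> ?A)) \<and> ((?B1 \<longleftrightarrow> ?B) \<and> (?B2 \<longrightarrow> ?B)) \<and>
    ((?C1 \<longleftrightarrow> ?C) \<and> (?C2 \<longrightarrow> ?C)) \<and> ((?D1 \<longleftrightarrow> ?D) \<and> (?D2 \<longrightarrow> ?D))")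
proof -
  have "?A" if "?A1" using that by (elim exE conjE) (drule (1) embeds_intoD, blast)
  moreover have "?A" if "?A2" using that by (elim exE conjE) (drule (1) embeds_intoD, blast)
  moreover have "?A1" if "?A"
    using that by (elim exE conjE) (drule (2) nested_noetherian_subbase_tree[OF assms], blast)
  moreover have "?B" if "?B1"
    using that by (elim exE conjE) (frule special_tree_is_tree, drule (1) embeds_intoD, blast)
  moreover have "?B" if "?B2"
    using that by (elim exE conjE) (frule special_tree_is_tree, drule (1) embeds_intoD, blast)
  moreover have "?B1" if "?B"
    using that by (elim exE conjE) (drule (2) nested_noetherian_subbase_tree[OF assms], blast)
  moreover have "?C" if "?C1" using that by (elim exE conjE) (drule (1) embeds_ontoD, blast)
  moreover have "?C" if "?C2" using that by (elim exE conjE) (drule (1) embeds_ontoD, blast)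
  moreover have "?C1" if "?C"
    using that by (elim exE conjE) (drule (2) nested_noetherian_subbase_tree[OF assms], blast)
  moreover have "?D" if "?D1"
    using that by (elim exE conjE) (frule special_tree_is_tree, drule (1) embeds_ontoD, blast)
  moreover have "?D" if "?D2"
    using that by (elim exE conjE) (frule special_tree_is_tree, drule (1) embeds_ontoD, blast)
  moreover have "?D1" if "?D"
    using that by (elim exE conjE) (drule (2) nested_noetherian_subbase_tree[OF assms], blast)
  ultimately show ?thesis by argo
qed

end
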